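(* Consider an $N$-agent static team problem such that: (a) the cost function $c$ is bounded and, for each fixed $x\in\mathsf X$, the map $(\mathbf y,\mathbf u)\mapsto c(x,\mathbf y,\mathbf u)$ is continuous; (b) each $\mathsf U^i$ is a convex subset of a locally convex vector space; (c) each $\mathsf Y^i$ is compact. For each $i$ and $n\ge 1$, let $\mathsf Y^i_n\subset\mathsf Y^i$ be a finite $1/n$-net in $\mathsf Y^i$ with nearest neighbor quantizer $q_n^i:\mathsf Y^i\to\mathsf Y_n^i$, let $\Gamma_n^i:=\{\gamma^i\circ q_n^i:\gamma^i\in\Gamma^i\}$ and $\mathbf\Gamma_n:=\prod_{i=1}^N\Gamma_n^i$. Then $$\lim_{n\to\infty}\ \inf_{\underline\gamma\in\mathbf\Gamma_n}J(\underline\gamma)=J^*.$$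
   Context: Static team problem: a Borel space is a Borel subset of a complete separable metric space, with its Borel $\sigma$-algebra. $\mathsf X$ is a Borel space with a probability measure $\mathbb P$; for $i=1,\dots,N$ the observation space $\mathsf Y^i$ (with metric $d_i$) and the action space $\mathsf U^i$ are Borel spaces, and $W^i(\cdot|x)$ is a stochastic kernel on $\mathsf Y^i$ given $\mathsf X$. Put $\mathsf Y=\prod_i\mathsf Y^i$, $\mathsf U=\prod_i\mathsf U^i$, and $\mathbb P(dx,d\mathbf y)=\mathbb P(dx)\prod_{i=1}^N W^i(dy^i|x)$. The cost $c:\mathsf X\times\mathsf Y\times\mathsf U\to[0,\infty)$ is Borel measurable. $\Gamma^i$ is the set of measurable maps $\gamma^i:\mathsf Y^i\to\mathsf U^i$, $\mathbf\Gamma=\prod_i\Gamma^i$, $\underline\gamma(\mathbf y)=(\gamma^1(y^1),\dots,\gamma^N(y^N))$, $J(\underline\gamma)=\int c(x,\mathbf y,\underline\gamma(\mathbf y))\,\mathbb P(dx,d\mathbf y)$ and $J^*=\inf_{\underline\gamma\in\mathbf\Gamma}J(\underline\gamma)$. A finite set $\mathsf Y_n^i\subset\mathsf Y^i$ is a $1/n$-net if $\min_{z\in\mathsf Y_n^i}d_i(y,z)<1/n$ for all $y\in\mathsf Y^i$. The nearest neighbor quantizer is $q_n^i(y)=\arg\min_{z\in\mathsf Y_n^i}d_i(y,z)$, with ties broken so that $q_n^i$ is measurable. *)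

theory Defs
  imports "HOL-Probability.Probability"
begin

text \<open>
  Encoding of the spaces. A Borel space is a Borel subset of a type of class \<open>polish_space\<close>,
  with the trace of the Borel sigma-algebra (\<open>restrict_space borel A\<close>). The observation
  spaces of the agents \<open>1, \<dots>, N\<close> are different subsets of one type, and likewise the action
  spaces. This costs no generality: the disjoint union of finitely many Polish spaces is Polish
  and contains each of them as a Borel (clopen) subset with its own topology. The metric
  \<open>d i\<close> on \<open>Y i\<close> is a separate parameter: any metric that induces the topology of \<open>Y i\<close>, not
  necessarily the restriction of the distance of the ambient type.
\<close>

locale static_team =
  fixes N :: nat
    and X :: "'x::polish_space set" and P :: "'x measure"
    and Y :: "nat \<Rightarrow> 'y::polish_space set" and d :: "nat \<Rightarrow> 'y \<Rightarrow> 'y \<Rightarrow> real"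
    and W :: "nat \<Rightarrow> 'x \<Rightarrow> 'y measure"
    and U :: "nat \<Rightarrow> 'u::polish_space set"
    and c :: "'x \<Rightarrow> (nat \<Rightarrow> 'y) \<Rightarrow> (nat \<Rightarrow> 'u) \<Rightarrow> real"
  assumes X_borel: "X \<in> sets borel"
    and P_prob: "prob_space P"
    and P_sets: "sets P = sets (restrict_space borel X)"
    and Y_borel: "\<And>i. i \<in> {1..N} \<Longrightarrow> Y i \<in> sets borel"
    and Y_metric: "\<And>i. i \<in> {1..N} \<Longrightarrow> Metric_space (Y i) (d i)"
    and Y_topology: "\<And>i. i \<in> {1..N} \<Longrightarrow> Metric_space.mtopology (Y i) (d i) = top_of_set (Y i)"
    and U_borel: "\<And>i. i \<in> {1..N} \<Longrightarrow> U i \<in> sets borel"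
    and W_kernel: "\<And>i. i \<in> {1..N} \<Longrightarrow>
          W i \<in> restrict_space borel X \<rightarrow>\<^sub>M prob_algebra (restrict_space borel (Y i))"
    and c_measurable:
          "(\<lambda>(x, y, u). c x y u) \<in> borel_measurable
             (restrict_space borel X \<Otimes>\<^sub>M (\<Pi>\<^sub>M i\<in>{1..N}. restrict_space borel (Y i))
                \<Otimes>\<^sub>M (\<Pi>\<^sub>M i\<in>{1..N}. restrict_space borel (U i)))"
    and c_nonneg:
          "\<And>x y u. x \<in> X \<Longrightarrow> y \<in> (\<Pi>\<^sub>E i\<in>{1..N}. Y i) \<Longrightarrow> u \<in> (\<Pi>\<^sub>E i\<in>{1..N}. U i) \<Longrightarrow> 0 \<le> c x y u"

text \<open>The joint law \<open>P(dx) W\<^sup>1(dy\<^sup>1|x) \<dots> W\<^sup>N(dy\<^sup>N|x)\<close> on the product of \<open>X\<close> and the \<open>Y i\<close>.\<close>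

definition joint_law ::
  "nat \<Rightarrow> 'x::polish_space set \<Rightarrow> 'x measure \<Rightarrow> (nat \<Rightarrow> 'y::polish_space set) \<Rightarrow>
   (nat \<Rightarrow> 'x \<Rightarrow> 'y measure) \<Rightarrow> ('x \<times> (nat \<Rightarrow> 'y)) measure" where
  "joint_law N X P Y W =
     P \<bind> (\<lambda>x. distr (\<Pi>\<^sub>M i\<in>{1..N}. W i x)
                  (restrict_space borel X \<Otimes>\<^sub>M (\<Pi>\<^sub>M i\<in>{1..N}. restrict_space borel (Y i)))
                  (\<lambda>y. (x, y)))"

text \<open>
  The expected cost is a nonnegative integral with values in \<open>[0, \<infinity>]\<close>, so that infima of costs
  are taken in a complete lattice.
\<close>

definition team_cost ::
  "nat \<Rightarrow> 'x::polish_space set \<Rightarrow> 'x measure \<Rightarrow> (nat \<Rightarrow> 'y::polish_space set) \<Rightarrow>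
   (nat \<Rightarrow> 'x \<Rightarrow> 'y measure) \<Rightarrow> ('x \<Rightarrow> (nat \<Rightarrow> 'y) \<Rightarrow> (nat \<Rightarrow> 'u) \<Rightarrow> real) \<Rightarrow>
   (nat \<Rightarrow> 'y \<Rightarrow> 'u) \<Rightarrow> ennreal" where
  "team_cost N X P Y W c \<gamma> =
     (\<integral>\<^sup>+ (x, y). ennreal (c x y (\<lambda>i\<in>{1..N}. \<gamma> i (y i))) \<partial>joint_law N X P Y W)"

definition agent_policies ::
  "'y::topological_space set \<Rightarrow> 'u::topological_space set \<Rightarrow> ('y \<Rightarrow> 'u) set" where
  "agent_policies A B = restrict_space borel A \<rightarrow>\<^sub>M restrict_space borel B"

definition team_policies ::
  "nat \<Rightarrow> (nat \<Rightarrow> 'y::topological_space set) \<Rightarrow> (nat \<Rightarrow> 'u::topological_space set) \<Rightarrow>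
   (nat \<Rightarrow> 'y \<Rightarrow> 'u) set" where
  "team_policies N Y U = (\<Pi>\<^sub>E i\<in>{1..N}. agent_policies (Y i) (U i))"

definition quantized_policies ::
  "nat \<Rightarrow> (nat \<Rightarrow> 'y::topological_space set) \<Rightarrow> (nat \<Rightarrow> 'u::topological_space set) \<Rightarrow>
   (nat \<Rightarrow> 'y \<Rightarrow> 'y) \<Rightarrow> (nat \<Rightarrow> 'y \<Rightarrow> 'u) set" where
  "quantized_policies N Y U q =
     (\<Pi>\<^sub>E i\<in>{1..N}. (\<lambda>\<gamma>. \<gamma> \<circ> q i) ` agent_policies (Y i) (U i))"

definition finite_net :: "'y set \<Rightarrow> ('y \<Rightarrow> 'y \<Rightarrow> real) \<Rightarrow> real \<Rightarrow> 'y set \<Rightarrow> bool" where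
  "finite_net A \<delta> \<epsilon> Z \<longleftrightarrow> finite Z \<and> Z \<subseteq> A \<and> (\<forall>y\<in>A. \<exists>z\<in>Z. \<delta> y z < \<epsilon>)"

definition nearest_neighbor_quantizer ::
  "'y::topological_space set \<Rightarrow> ('y \<Rightarrow> 'y \<Rightarrow> real) \<Rightarrow> 'y set \<Rightarrow> ('y \<Rightarrow> 'y) \<Rightarrow> bool" where
  "nearest_neighbor_quantizer A \<delta> Z q \<longleftrightarrow>
     q \<in> restrict_space borel A \<rightarrow>\<^sub>M restrict_space borel A \<and>
     (\<forall>y\<in>A. is_arg_min (\<delta> y) (\<lambda>z. z \<in> Z) (q y))"

text \<open>
  A locally convex real vector space whose carrier is the linear subspace \<open>topspace T\<close> of the
  type. The Hausdorff axiom is not imposed.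
\<close>

definition locally_convex_space :: "'v::real_vector topology \<Rightarrow> bool" where
  "locally_convex_space T \<longleftrightarrow>
     subspace (topspace T) \<and>
     continuous_map (prod_topology T T) T (\<lambda>(v, w). v + w) \<and>
     continuous_map (prod_topology euclideanreal T) T (\<lambda>(r, v). r *\<^sub>R v) \<and>
     (\<forall>S. openin T S \<and> 0 \<in> S \<longrightarrow> (\<exists>C. openin T C \<and> convex C \<and> 0 \<in> C \<and> C \<subseteq> S))"

end

theory Submission
  imports Defs
begin

text \<open>
  A policy with countably many values coincides, outside a set of small probability, with a policy
  that is locally constant near each point of a compact set: this is Lusin's theorem together with
  Tietze's extension theorem for the index of the value. Such a policy can be precomposed with the
  quantizers, because \<open>q\<^sub>n y \<rightarrow> y\<close>. Policies with countably many values approximate every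
  measurable policy pointwise, and the cost passes to the limit by dominated convergence.
\<close>

section \<open>Approximation of measurable maps\<close>

text \<open>Every quantized policy is a policy, so only the upper bound on the limit needs work. The
  obstacle there is that \<open>\<gamma> \<circ> q n\<close> samples \<open>\<gamma>\<close> at
  finitely many points, which may form a null set: closeness of two policies in measure says nothing
  about their quantized versions. The policy to be quantized must therefore be controlled on full
  neighbourhoods of most points, not merely on a large set. Extending an integer index instead of
  the action reduces this to real functions: rounding gives an integer again, and decoding it keeps
  every action in \<open>U i\<close>. The policy and its exceptional set are fixed before
  \<open>n\<close> grows; that set costs at most the bound of \<open>c\<close> times its
  probability, which is chosen to fit into the gap left by a strict inequality.\<close>

lemma inner_regular_measure:
  fixes M :: "'a::polish_space measure"
  assumes M: "sets M = sets borel" "finite_measure M" and B: "B \<in> sets borel" and e: "0 < e"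
  obtains K where "K \<subseteq> B" "compact K" "measure M (B - K) < e"
proof -
  interpret finite_measure M by fact
  have "\<exists>K. K \<subseteq> B \<and> compact K \<and> measure M B - e < measure M K"
  \<comment> \<open>\<open>ennreal\<close> sends negative reals to \<open>0\<close>, so the supremum
    is used only when \<open>measure M B - e\<close> is nonnegative; otherwise the empty set already
    does.\<close>
  proof (cases "measure M B < e")
    case True
    then show ?thesis by (intro exI[of _ "{}"]) auto
  next
    case False
    have "ennreal (measure M B - e) < emeasure M B"
      using False e by (subst emeasure_eq_measure) (intro ennreal_lessI; linarith)
    also have "emeasure M B = (SUP K \<in> {K. K \<subseteq> B \<and> compact K}. emeasure M K)"
      using M B by (intro inner_regular) auto
    finally obtain K where K: "K \<subseteq> B" "compact K" "ennreal (measure M B - e) < emeasure M K"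
      by (auto simp: less_SUP_iff)
    then have "measure M B - e < measure M K"
      using False by (simp add: emeasure_eq_measure ennreal_less_iff)
    with K show ?thesis by blast
  qed
  then obtain K where K: "K \<subseteq> B" "compact K" "measure M B - e < measure M K" by blast
  have "measure M (B - K) = measure M B - measure M K"
    using K B M by (intro finite_measure_Diff) (auto intro: borel_compact)
  then have "measure M (B - K) < e" using K(3) by linarith
  with K(1,2) show thesis by (rule that)
qed

text \<open>On a finite disjoint union \<open>K\<close> of compact pieces of level sets,
  \<open>\<phi>\<close> is continuous. A real extension \<open>g\<close> stays within
  \<open>1 / 2\<close> of the integer \<open>\<phi> x\<close> near each \<open>x \<in> K\<close>, so
  rounding recovers that integer exactly. The neighbourhoods are those of the whole space because a
  quantized point need not stay in \<open>K\<close>.\<close>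

lemma locally_constant_approximation:
  fixes M :: "'a::polish_space measure" and \<phi> :: "'a \<Rightarrow> nat"
  assumes M: "sets M = sets borel" "finite_measure M"
    and \<phi>[measurable]: "\<phi> \<in> borel \<rightarrow>\<^sub>M count_space UNIV" and e: "0 < e"
  obtains K \<psi> where "compact K" "measure M (- K) < e" "\<psi> \<in> borel \<rightarrow>\<^sub>M count_space UNIV"
    "\<And>x. x \<in> K \<Longrightarrow> \<forall>\<^sub>F z in nhds x. \<psi> z = \<phi> x"
proof -
  interpret finite_measure M by fact
  \<comment> \<open>Gluing along closed pieces works for finitely many of them. The tails
    \<open>T n\<close> decrease to the empty set, so all but finitely many levels can be given up at
    a price below \<open>e / 2\<close>.\<close>
  define T where "T n = {x. n \<le> \<phi> x}" for n
  have T[measurable]: "T n \<in> sets borel" for n unfolding T_def by measurable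
  have Tm: "T n \<in> sets M" for n using T by (simp add: M(1))
  have "(\<Inter>n. T n) = {}"
  proof (rule equals0I)
    fix x assume "x \<in> (\<Inter>n. T n)"
    then have "x \<in> T (Suc (\<phi> x))" by (rule INT_D) simp
    then show False by (simp add: T_def)
  qed
  moreover have "(\<lambda>n. measure M (T n)) \<longlonglongrightarrow> measure M (\<Inter>n. T n)"
  proof (rule finite_Lim_measure_decseq)
    show "range T \<subseteq> sets M" using Tm by blast
    show "decseq T" unfolding decseq_def T_def by fastforce
  qed
  ultimately have "(\<lambda>n. measure M (T n)) \<longlonglongrightarrow> 0" by simp
  then have "\<forall>\<^sub>F n in sequentially. measure M (T n) < e / 2"
    using e by (intro order_tendstoD(2)) auto
  then obtain n where n: "measure M (T n) < e / 2"
    using eventually_happens'[OF sequentially_bot] by blast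
  have level[measurable]: "\<phi> -` {j} \<in> sets borel" for j
    using measurable_sets[OF \<phi>, of "{j}"] by simp
  \<comment> \<open>The \<open>n\<close> retained levels share the other \<open>e / 2\<close>; the
    \<open>+ 1\<close> covers \<open>n = 0\<close>.\<close>
  have "\<exists>K. K \<subseteq> \<phi> -` {j} \<and> compact K \<and> measure M (\<phi> -` {j} - K) < e / (2 * (real n + 1))" for j
    using inner_regular_measure[OF M level, of "e / (2 * (real n + 1))" j] e by auto
  then obtain L where L: "\<And>j. L j \<subseteq> \<phi> -` {j}" "\<And>j. compact (L j)"
      "\<And>j. measure M (\<phi> -` {j} - L j) < e / (2 * (real n + 1))"
    by metis
  define K where "K = (\<Union>j<n. L j)"
  have K: "compact K" unfolding K_def using L by auto
  have meas: "\<phi> -` {j} - L j \<in> sets M" for j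
    using level[of j] borel_compact[OF L(2)[of j]] unfolding M(1) by (rule sets.Diff)
  have "measure M (- K) \<le> measure M (T n \<union> (\<Union>j<n. \<phi> -` {j} - L j))"
  proof (rule finite_measure_mono)
    show "- K \<subseteq> T n \<union> (\<Union>j<n. \<phi> -` {j} - L j)"
      by (auto simp: K_def T_def not_le)
    show "T n \<union> (\<Union>j<n. \<phi> -` {j} - L j) \<in> sets M"
      using meas by (intro sets.Un Tm sets.finite_UN) simp_all
  qed
  also have "\<dots> \<le> measure M (T n) + measure M (\<Union>j<n. \<phi> -` {j} - L j)"
    using meas by (intro measure_Un_le Tm sets.finite_UN) simp_all
  also have "measure M (\<Union>j<n. \<phi> -` {j} - L j) \<le> (\<Sum>j<n. measure M (\<phi> -` {j} - L j))"
    using meas by (intro measure_UNION_le) auto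
  also have "\<dots> \<le> (\<Sum>j<n. e / (2 * (real n + 1)))"
    using L(3) by (intro sum_mono) (simp add: less_imp_le)
  also have "\<dots> \<le> e / 2" using e by (simp add: field_simps)
  finally have small: "measure M (- K) < e" using n by linarith
  have "continuous_on K (\<lambda>x. real (\<phi> x))"
    unfolding K_def
  proof (rule continuous_on_closed_Union)
    fix j
    have "continuous_on (L j) (\<lambda>x. real j)" by simp
    then show "continuous_on (L j) (\<lambda>x. real (\<phi> x))"
      by (rule continuous_on_eq) (use L(1) in auto)
  qed (use L(2) in \<open>auto intro: compact_imp_closed\<close>)
  moreover have "norm (real (\<phi> x)) \<le> real n" if "x \<in> K" for x
    using that L(1) by (fastforce simp: K_def)
  moreover have "closedin (top_of_set UNIV) K"
    using compact_imp_closed[OF K] by simp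
  ultimately obtain g where g: "continuous_on UNIV g" "\<And>x. x \<in> K \<Longrightarrow> g x = real (\<phi> x)"
    using Tietze[of K "\<lambda>x. real (\<phi> x)" UNIV "real n"] by (metis of_nat_0_le_iff)
  have [measurable]: "g \<in> borel_measurable borel"
    using g(1) by (rule borel_measurable_continuous_onI)
  show thesis
  proof (rule that[OF K small])
    \<comment> \<open>The witness for \<psi> is the integer nearest to \<open>g\<close>, with
      negative integers sent to \<open>0\<close>. Away from \<open>K\<close> no particular value is
      asked for, only measurability.\<close>
    show "(\<lambda>x. nat (round (g x))) \<in> borel \<rightarrow>\<^sub>M count_space UNIV"
      unfolding round_def by measurable
    fix x assume x: "x \<in> K"
    have "(g \<longlongrightarrow> g x) (nhds x)"
      using g(1) by (simp add: continuous_on_eq_continuous_at isCont_def tendsto_at_iff_tendsto_nhds)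
    then have "(g \<longlongrightarrow> real (\<phi> x)) (nhds x)"
      using g(2)[OF x] by simp
    then have "\<forall>\<^sub>F z in nhds x. dist (g z) (real (\<phi> x)) < 1 / 2"
      by (rule tendstoD) simp
    then show "\<forall>\<^sub>F z in nhds x. nat (round (g z)) = \<phi> x"
    proof eventually_elim
      case (elim z)
      then have "round (g z) = int (\<phi> x)"
        by (intro round_unique') (simp add: dist_real_def)
      then show ?case by simp
    qed
  qed
qed

text \<open>\<open>D\<close> enumerates a countable dense subset of \<open>U\<close> itself, so
  every approximating value is an admissible action, and \<open>\<phi>\<close> takes the least index
  that is close enough. Index and values are returned separately because only the index is modified
  afterwards.\<close>

lemma countable_range_approximation:
  fixes f :: "'a \<Rightarrow> 'u::polish_space"
  assumes f[measurable]: "f \<in> borel_measurable M" and fU: "\<And>x. f x \<in> U" and e: "0 < e"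
  obtains D :: "nat \<Rightarrow> 'u" and \<phi> where "range D \<subseteq> U" "\<phi> \<in> M \<rightarrow>\<^sub>M count_space UNIV"
    "\<And>x. dist (D (\<phi> x)) (f x) < e"
proof -
  obtain S where S: "countable S" "S \<subseteq> U" "U \<subseteq> closure S" by (rule separable)
  have "S \<noteq> {}" using S(3) fU by auto
  define D where "D = from_nat_into S"
  have D: "range D = S"
    unfolding D_def using S \<open>S \<noteq> {}\<close> by (simp add: range_from_nat_into)
  define \<phi> where "\<phi> x = (LEAST j. dist (D j) (f x) < e)" for x
  have ex: "\<exists>j. dist (D j) (f x) < e" for x
  proof -
    have "f x \<in> closure S" using fU S by auto
    then obtain s where "s \<in> S" "dist s (f x) < e"
      using e by (auto simp: closure_approachable)
    then show ?thesis using D by (metis imageE)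
  qed
  show thesis
  proof (rule that)
    show "range D \<subseteq> U" using D S by simp
    show "\<phi> \<in> M \<rightarrow>\<^sub>M count_space UNIV" unfolding \<phi>_def by measurable
    show "dist (D (\<phi> x)) (f x) < e" for x
      unfolding \<phi>_def using LeastI_ex[OF ex] .
  qed
qed

section \<open>Products of kernels\<close>

text \<open>Measurability of a probability kernel need only be checked on an intersection-stable
  generator, and on a box the product measure is a finite product of measurable functions of
  \<open>x\<close>.\<close>

lemma measurable_PiM_prob_algebra:
  assumes I: "finite I" and K: "\<And>i. i \<in> I \<Longrightarrow> K i \<in> M \<rightarrow>\<^sub>M prob_algebra (R i)"
  shows "(\<lambda>x. \<Pi>\<^sub>M i\<in>I. K i x) \<in> M \<rightarrow>\<^sub>M prob_algebra (\<Pi>\<^sub>M i\<in>I. R i)"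
proof -
  have KD: "prob_space (K i x)" "sets (K i x) = sets (R i)" if "x \<in> space M" "i \<in> I" for i x
    using measurable_space[OF K that(1)] that by (auto simp: space_prob_algebra)
  show ?thesis
  proof (rule measurable_prob_algebra_generated[OF sets_PiM Int_stable_prod_algebra
        prod_algebra_sets_into_space])
    fix x assume "x \<in> space M"
    then show "prob_space (\<Pi>\<^sub>M i\<in>I. K i x)" "sets (\<Pi>\<^sub>M i\<in>I. K i x) = sets (\<Pi>\<^sub>M i\<in>I. R i)"
      using KD by (auto intro!: prob_space_PiM sets_PiM_cong)
  next
    fix A assume "A \<in> prod_algebra I R"
    then obtain E where A: "A = Pi\<^sub>E I E" and E: "E \<in> (\<Pi> i\<in>I. sets (R i))"
      by (rule prod_algebraE_all)
    have "emeasure (\<Pi>\<^sub>M i\<in>I. K i x) A = (\<Prod>i\<in>I. emeasure (K i x) (E i))" if x: "x \<in> space M" for x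
    proof -
      \<comment> \<open>The product locale asks for sigma-finite measures at every index, so a point
        mass is placed outside \<open>I\<close>; \<open>PiM\<close> over \<open>I\<close> does not
        see it.\<close>
      let ?K = "\<lambda>i. if i \<in> I then K i x else count_space {undefined}"
      have "prob_space (?K i)" for i
        using KD(1)[OF x] by (cases "i \<in> I") (auto intro!: prob_spaceI)
      then interpret product_sigma_finite ?K
        by (intro product_sigma_finite.intro prob_space_imp_sigma_finite)
      have "emeasure (\<Pi>\<^sub>M i\<in>I. K i x) A = emeasure (PiM I ?K) A"
        by (intro arg_cong2[where f=emeasure] PiM_cong) auto
      also have "\<dots> = (\<Prod>i\<in>I. emeasure (?K i) (E i))"
        unfolding A using E KD[OF x] I by (intro emeasure_PiM) (auto simp: Pi_iff)
      finally show ?thesis by simp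
    qed
    moreover have "(\<lambda>x. \<Prod>i\<in>I. emeasure (K i x) (E i)) \<in> borel_measurable M"
      using E K by (intro borel_measurable_prod_ennreal measurable_emeasure_kernel)
        (auto intro: measurable_prob_algebraD)
    ultimately show "(\<lambda>x. emeasure (\<Pi>\<^sub>M i\<in>I. K i x) A) \<in> borel_measurable M"
      by (simp cong: measurable_cong)
  qed
qed

section \<open>Convergence of the cost\<close>

context static_team
begin

section \<open>The joint law as a probability measure\<close>

abbreviation state_observation_space where
  "state_observation_space \<equiv>
     restrict_space borel X \<Otimes>\<^sub>M (\<Pi>\<^sub>M i\<in>{1..N}. restrict_space borel (Y i))"

text \<open>Pushing the product kernel forward along \<open>y \<mapsto> (x, y)\<close> gives a
  probability kernel, and binding a probability measure with such a kernel gives a probability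
  measure. The sigma-algebra and the total mass of the joint law are both read off from this
  membership.\<close>

lemma joint_law_in_prob_algebra: "joint_law N X P Y W \<in> space (prob_algebra state_observation_space)"
proof -
  have P: "P \<in> space (prob_algebra (restrict_space borel X))"
    using P_prob P_sets by (simp add: space_prob_algebra)
  have "(\<lambda>x. \<Pi>\<^sub>M i\<in>{1..N}. W i x) \<in> restrict_space borel X \<rightarrow>\<^sub>M
          prob_algebra (\<Pi>\<^sub>M i\<in>{1..N}. restrict_space borel (Y i))"
    using W_kernel by (intro measurable_PiM_prob_algebra) auto
  then have K: "(\<lambda>x. distr (\<Pi>\<^sub>M i\<in>{1..N}. W i x) state_observation_space (\<lambda>y. (x, y)))
      \<in> restrict_space borel X \<rightarrow>\<^sub>M prob_algebra state_observation_space"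
    by (rule measurable_distr_prob_space2) simp
  show ?thesis
    unfolding joint_law_def space_prob_algebra
    using prob_space_bind'[OF P K] sets_bind'[OF P K] by simp
qed

lemma sets_joint_law [measurable_cong]:
  "sets (joint_law N X P Y W) = sets state_observation_space"
  using joint_law_in_prob_algebra by (simp add: space_prob_algebra)

lemma prob_space_joint_law: "prob_space (joint_law N X P Y W)"
  using joint_law_in_prob_algebra by (simp add: space_prob_algebra)

lemma space_joint_law: "space (joint_law N X P Y W) = X \<times> (\<Pi>\<^sub>E i\<in>{1..N}. Y i)"
  by (simp add: sets_eq_imp_space_eq[OF sets_joint_law] space_pair_measure space_PiM
      space_restrict_space)

text \<open>A probability measure cannot live on an empty space, and one empty factor would empty
  the product.\<close>

lemma Y_nonempty: "i \<in> {1..N} \<Longrightarrow> Y i \<noteq> {}"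
  using prob_space.not_empty[OF prob_space_joint_law] by (auto simp: space_joint_law)

lemma measurable_observation [measurable]:
  "i \<in> {1..N} \<Longrightarrow> (\<lambda>p. snd p i) \<in> joint_law N X P Y W \<rightarrow>\<^sub>M restrict_space borel (Y i)"
  by measurable

lemma measurable_cost_policy:
  assumes \<gamma>: "\<And>i. i \<in> {1..N} \<Longrightarrow> \<gamma> i \<in> agent_policies (Y i) (U i)"
  shows "(\<lambda>p. c (fst p) (snd p) (\<lambda>i\<in>{1..N}. \<gamma> i (snd p i)))
           \<in> borel_measurable (joint_law N X P Y W)"
proof -
  have act: "(\<lambda>p. \<lambda>i\<in>{1..N}. \<gamma> i (snd p i))
      \<in> joint_law N X P Y W \<rightarrow>\<^sub>M (\<Pi>\<^sub>M i\<in>{1..N}. restrict_space borel (U i))"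
  proof (rule measurable_restrict)
    fix i assume i: "i \<in> {1..N}"
    show "(\<lambda>p. \<gamma> i (snd p i)) \<in> joint_law N X P Y W \<rightarrow>\<^sub>M restrict_space borel (U i)"
      using measurable_observation[OF i] \<gamma>[OF i] unfolding agent_policies_def
      by (rule measurable_compose)
  qed
  have "(\<lambda>p. (fst p, snd p, \<lambda>i\<in>{1..N}. \<gamma> i (snd p i))) \<in> joint_law N X P Y W \<rightarrow>\<^sub>M
      restrict_space borel X \<Otimes>\<^sub>M (\<Pi>\<^sub>M i\<in>{1..N}. restrict_space borel (Y i))
        \<Otimes>\<^sub>M (\<Pi>\<^sub>M i\<in>{1..N}. restrict_space borel (U i))"
    by (rule measurable_Pair[OF _ measurable_Pair[OF _ act]]) measurable
  from measurable_compose[OF this c_measurable] show ?thesis by simp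
qed

lemma policy_value:
  assumes "\<gamma> \<in> agent_policies (Y i) (U i)" "y \<in> Y i"
  shows "\<gamma> y \<in> U i"
  using measurable_space[OF assms(1)[unfolded agent_policies_def], of y] assms(2)
  by (simp add: space_restrict_space)

section \<open>Dominated convergence of the cost and its bound off a good set\<close>

text \<open>At each point of \<open>G\<close> the actions converge coordinatewise, so continuity of
  \<open>c x\<close> gives pointwise convergence of the integrand, and the constant \<open>C\<close>
  dominates it under a probability measure. Restricting to \<open>G\<close> allows the policies to
  misbehave on an exceptional set.\<close>

lemma cost_tendsto_on:
  fixes \<gamma> :: "nat \<Rightarrow> nat \<Rightarrow> 'y \<Rightarrow> 'u"
  assumes bound: "\<And>x y u. x \<in> X \<Longrightarrow> y \<in> (\<Pi>\<^sub>E i\<in>{1..N}. Y i) \<Longrightarrow> u \<in> (\<Pi>\<^sub>E i\<in>{1..N}. U i) \<Longrightarrow> c x y u \<le> C"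
    and cont: "\<And>x. x \<in> X \<Longrightarrow>
         continuous_map
           (prod_topology (product_topology (\<lambda>i. top_of_set (Y i)) {1..N})
                          (product_topology (\<lambda>i. top_of_set (U i)) {1..N}))
           euclideanreal (\<lambda>(y, u). c x y u)"
    and \<gamma>: "\<And>n i. i \<in> {1..N} \<Longrightarrow> \<gamma> n i \<in> agent_policies (Y i) (U i)"
    and \<gamma>': "\<And>i. i \<in> {1..N} \<Longrightarrow> \<gamma>' i \<in> agent_policies (Y i) (U i)"
    and G: "G \<in> sets (joint_law N X P Y W)"
    and lim: "\<And>x y i. (x, y) \<in> G \<Longrightarrow> i \<in> {1..N} \<Longrightarrow> (\<lambda>n. \<gamma> n i (y i)) \<longlonglongrightarrow> \<gamma>' i (y i)"
  shows "(\<lambda>n. \<integral>\<^sup>+ p. ennreal (c (fst p) (snd p) (\<lambda>i\<in>{1..N}. \<gamma> n i (snd p i))) * indicator G p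
              \<partial>joint_law N X P Y W)
         \<longlonglongrightarrow> (\<integral>\<^sup>+ p. ennreal (c (fst p) (snd p) (\<lambda>i\<in>{1..N}. \<gamma>' i (snd p i))) * indicator G p
              \<partial>joint_law N X P Y W)"
proof (rule nn_integral_dominated_convergence[where w="\<lambda>_. ennreal C"])
  let ?L = "joint_law N X P Y W"
  interpret L: prob_space ?L by (rule prob_space_joint_law)
  show "(\<integral>\<^sup>+p. ennreal C \<partial>?L) < \<infinity>" by (simp add: L.emeasure_space_1)
  show "(\<lambda>p. ennreal (c (fst p) (snd p) (\<lambda>i\<in>{1..N}. \<gamma> n i (snd p i))) * indicator G p)
      \<in> borel_measurable ?L" for n
    using measurable_cost_policy[of "\<gamma> n", OF \<gamma>] G by simp
  show "(\<lambda>p. ennreal (c (fst p) (snd p) (\<lambda>i\<in>{1..N}. \<gamma>' i (snd p i))) * indicator G p)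
      \<in> borel_measurable ?L"
    using measurable_cost_policy[OF \<gamma>'] G by simp
  have val: "(\<lambda>i\<in>{1..N}. g i (y i)) \<in> (\<Pi>\<^sub>E i\<in>{1..N}. U i)"
    if "y \<in> (\<Pi>\<^sub>E i\<in>{1..N}. Y i)" "\<And>i. i \<in> {1..N} \<Longrightarrow> g i \<in> agent_policies (Y i) (U i)" for g y
    using that by (auto intro!: policy_value)
  show "AE p in ?L. ennreal (c (fst p) (snd p) (\<lambda>i\<in>{1..N}. \<gamma> n i (snd p i))) * indicator G p \<le> ennreal C" for n
  proof (rule AE_I2)
    fix p assume "p \<in> space ?L"
    then have "c (fst p) (snd p) (\<lambda>i\<in>{1..N}. \<gamma> n i (snd p i)) \<le> C"
      using \<gamma> by (intro bound val) (auto simp: space_joint_law)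
    then show "ennreal (c (fst p) (snd p) (\<lambda>i\<in>{1..N}. \<gamma> n i (snd p i))) * indicator G p \<le> ennreal C"
      by (auto simp: indicator_def intro: ennreal_leI)
  qed
  show "AE p in ?L. (\<lambda>n. ennreal (c (fst p) (snd p) (\<lambda>i\<in>{1..N}. \<gamma> n i (snd p i))) * indicator G p)
      \<longlonglongrightarrow> ennreal (c (fst p) (snd p) (\<lambda>i\<in>{1..N}. \<gamma>' i (snd p i))) * indicator G p"
  proof (rule AE_I2)
    fix p assume "p \<in> space ?L"
    then obtain x y where p: "p = (x, y)" "x \<in> X" "y \<in> (\<Pi>\<^sub>E i\<in>{1..N}. Y i)"
      by (auto simp: space_joint_law)
    show "(\<lambda>n. ennreal (c (fst p) (snd p) (\<lambda>i\<in>{1..N}. \<gamma> n i (snd p i))) * indicator G p)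
      \<longlonglongrightarrow> ennreal (c (fst p) (snd p) (\<lambda>i\<in>{1..N}. \<gamma>' i (snd p i))) * indicator G p"
    proof (cases "p \<in> G")
      case True
      let ?TU = "product_topology (\<lambda>i. top_of_set (U i)) {1..N}"
      let ?TY = "product_topology (\<lambda>i. top_of_set (Y i)) {1..N}"
      have "limitin ?TU (\<lambda>n. \<lambda>i\<in>{1..N}. \<gamma> n i (y i)) (\<lambda>i\<in>{1..N}. \<gamma>' i (y i)) sequentially"
        unfolding limitin_componentwise
      proof (intro conjI ballI)
        show "\<forall>\<^sub>F n in sequentially. (\<lambda>i\<in>{1..N}. \<gamma> n i (y i)) \<in> topspace ?TU"
          using val[OF p(3)] \<gamma> by (auto intro!: always_eventually)
        fix i assume i: "i \<in> {1..N}"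
        then have "y i \<in> Y i" using p by auto
        then show "limitin (top_of_set (U i)) (\<lambda>n. (\<lambda>i\<in>{1..N}. \<gamma> n i (y i)) i)
            ((\<lambda>i\<in>{1..N}. \<gamma>' i (y i)) i) sequentially"
          using i lim[of x y i] True p policy_value[OF \<gamma>] policy_value[OF \<gamma>']
          by (simp add: limitin_subtopology)
      qed auto
      \<comment> \<open>The cost sees the true observation; quantization changes only the actions,
        so this component is a constant sequence.\<close>
      moreover have "limitin ?TY (\<lambda>n. y) y sequentially"
        using p by (simp add: limitin_const_iff)
      ultimately have "limitin (prod_topology ?TY ?TU) (\<lambda>n. (y, \<lambda>i\<in>{1..N}. \<gamma> n i (y i)))
          (y, \<lambda>i\<in>{1..N}. \<gamma>' i (y i)) sequentially"
        by (simp add: limitin_pairwise o_def)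
      from continuous_map_limit[OF cont[OF p(2)] this]
      have "(\<lambda>n. c x y (\<lambda>i\<in>{1..N}. \<gamma> n i (y i))) \<longlonglongrightarrow> c x y (\<lambda>i\<in>{1..N}. \<gamma>' i (y i))"
        by (simp add: o_def)
      then show ?thesis using True p by (simp add: tendsto_ennrealI)
    qed simp
  qed
qed simp

lemma team_cost_eq:
  "team_cost N X P Y W c \<gamma> =
     (\<integral>\<^sup>+ p. ennreal (c (fst p) (snd p) (\<lambda>i\<in>{1..N}. \<gamma> i (snd p i))) \<partial>joint_law N X P Y W)"
  unfolding team_cost_def case_prod_unfold ..

text \<open>Off \<open>G\<close> nothing is known about the actions, so the cost is replaced by its
  bound there. The resulting error term does not depend on \<open>\<gamma>\<close> and hence serves
  a whole sequence of policies at once.\<close>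

lemma team_cost_le_on:
  assumes bound: "\<And>x y u. x \<in> X \<Longrightarrow> y \<in> (\<Pi>\<^sub>E i\<in>{1..N}. Y i) \<Longrightarrow> u \<in> (\<Pi>\<^sub>E i\<in>{1..N}. U i) \<Longrightarrow> c x y u \<le> C"
    and \<gamma>: "\<And>i. i \<in> {1..N} \<Longrightarrow> \<gamma> i \<in> agent_policies (Y i) (U i)"
    and G: "G \<in> sets (joint_law N X P Y W)"
  shows "team_cost N X P Y W c \<gamma> \<le>
    (\<integral>\<^sup>+ p. ennreal (c (fst p) (snd p) (\<lambda>i\<in>{1..N}. \<gamma> i (snd p i))) * indicator G p
       \<partial>joint_law N X P Y W)
    + ennreal C * emeasure (joint_law N X P Y W) (space (joint_law N X P Y W) - G)"
proof -
  let ?L = "joint_law N X P Y W"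
  let ?f = "\<lambda>p. ennreal (c (fst p) (snd p) (\<lambda>i\<in>{1..N}. \<gamma> i (snd p i)))"
  have "(\<lambda>p. ?f p * indicator G p) \<in> borel_measurable ?L"
    using measurable_cost_policy[OF \<gamma>] G by simp
  then have split: "(\<integral>\<^sup>+ p. ?f p * indicator G p + ennreal C * indicator (space ?L - G) p \<partial>?L)
      = (\<integral>\<^sup>+ p. ?f p * indicator G p \<partial>?L) + ennreal C * emeasure ?L (space ?L - G)"
    using G by (subst nn_integral_add) (simp_all add: nn_integral_cmult_indicator)
  have "team_cost N X P Y W c \<gamma> \<le>
      (\<integral>\<^sup>+ p. ?f p * indicator G p + ennreal C * indicator (space ?L - G) p \<partial>?L)"
    unfolding team_cost_eq
  proof (rule nn_integral_mono)
    fix p assume p: "p \<in> space ?L"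
    then have "c (fst p) (snd p) (\<lambda>i\<in>{1..N}. \<gamma> i (snd p i)) \<le> C"
      using \<gamma> by (intro bound) (auto simp: space_joint_law intro!: policy_value)
    then show "?f p \<le> ?f p * indicator G p + ennreal C * indicator (space ?L - G) p"
      using p by (auto simp: indicator_def intro: ennreal_leI)
  qed
  then show ?thesis unfolding split .
qed

section \<open>Quantizers and construction of policies\<close>

text \<open>The nearest net point is no farther away than the one promised by the net, which gives
  convergence in \<open>d i\<close>; equality of the metric topology with the trace topology turns
  it into convergence in the ambient type.\<close>

lemma quantizer_tendsto:
  assumes i: "i \<in> {1..N}" and y: "y \<in> Y i"
    and net: "\<And>n. finite_net (Y i) (d i) (1 / real (Suc n)) (Z n)"
    and q: "\<And>n. nearest_neighbor_quantizer (Y i) (d i) (Z n) (q n)"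
  shows "(\<lambda>n. q n y) \<longlonglongrightarrow> y"
proof -
  interpret Metric_space "Y i" "d i" by (rule Y_metric[OF i])
  have mem: "q n y \<in> Y i" for n
    using q[of n] y by (auto simp: nearest_neighbor_quantizer_def measurable_def space_restrict_space)
  have dist: "d i (q n y) y < 1 / real (Suc n)" for n
  proof -
    obtain z where z: "z \<in> Z n" "d i y z < 1 / real (Suc n)"
      using net[of n] y by (auto simp: finite_net_def)
    have "\<not> d i y z < d i y (q n y)"
      using q[of n] y z by (auto simp: nearest_neighbor_quantizer_def is_arg_min_def)
    with z show ?thesis by (simp add: commute)
  qed
  have "limitin mtopology (\<lambda>n. q n y) y sequentially"
    unfolding limit_metric_sequentially
  proof (intro conjI allI impI)
    fix e :: real assume "0 < e"
    then obtain m where m: "1 / real (Suc m) < e" using nat_approx_posE by metis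
    have "d i (q n y) y < e" if "n \<ge> m" for n
    proof -
      have "1 / real (Suc n) \<le> 1 / real (Suc m)" using that by (simp add: frac_le)
      then show ?thesis using dist[of n] m by linarith
    qed
    then show "\<exists>k. \<forall>n\<ge>k. q n y \<in> Y i \<and> d i (q n y) y < e" using mem by blast
  qed (rule y)
  then show ?thesis
    unfolding Y_topology[OF i] by (simp add: limitin_subtopology)
qed

text \<open>The approximation by countably many values is wanted on the whole type. A policy is
  continued off the Borel set \<open>Y i\<close> by one of its own values, which keeps it measurable
  and inside \<open>U i\<close>.\<close>

lemma agent_policies_imp_measurable_extension:
  assumes i: "i \<in> {1..N}" and \<gamma>: "\<gamma> \<in> agent_policies (Y i) (U i)"
  obtains f where "f \<in> borel_measurable borel" "\<And>y. f y \<in> U i" "\<And>y. y \<in> Y i \<Longrightarrow> f y = \<gamma> y"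
proof -
  obtain y0 where y0: "y0 \<in> Y i" using Y_nonempty[OF i] by auto
  show thesis
  proof
    have "\<gamma> \<in> borel_measurable (restrict_space borel (Y i))"
      using \<gamma> by (simp add: agent_policies_def measurable_restrict_space2_iff)
    then show "(\<lambda>y. if y \<in> Y i then \<gamma> y else \<gamma> y0) \<in> borel_measurable borel"
      using Y_borel[OF i] by (subst measurable_restrict_space_iff[symmetric]) auto
  qed (use policy_value[OF \<gamma>] y0 in auto)
qed

lemma agent_policies_comp_index:
  assumes "\<phi> \<in> borel \<rightarrow>\<^sub>M count_space UNIV" "range D \<subseteq> U i"
  shows "(\<lambda>y. D (\<phi> y)) \<in> agent_policies (Y i) (U i)"
proof -
  have "D \<in> count_space UNIV \<rightarrow>\<^sub>M restrict_space borel (U i)"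
    using assms(2) by (auto simp: space_restrict_space)
  from measurable_compose[OF measurable_restrict_space1[OF assms(1)] this]
  show ?thesis by (simp add: agent_policies_def)
qed

section \<open>The upper bound through policies with countably many values\<close>

lemma eventually_quantized_cost_less:
  assumes bound: "\<And>x y u. x \<in> X \<Longrightarrow> y \<in> (\<Pi>\<^sub>E i\<in>{1..N}. Y i) \<Longrightarrow> u \<in> (\<Pi>\<^sub>E i\<in>{1..N}. U i) \<Longrightarrow> c x y u \<le> C"
    and C: "0 \<le> C"
    and cont: "\<And>x. x \<in> X \<Longrightarrow>
         continuous_map
           (prod_topology (product_topology (\<lambda>i. top_of_set (Y i)) {1..N})
                          (product_topology (\<lambda>i. top_of_set (U i)) {1..N}))
           euclideanreal (\<lambda>(y, u). c x y u)"
    and q: "\<And>n i. i \<in> {1..N} \<Longrightarrow> q n i \<in> restrict_space borel (Y i) \<rightarrow>\<^sub>M restrict_space borel (Y i)"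
    and q_lim: "\<And>i y. i \<in> {1..N} \<Longrightarrow> y \<in> Y i \<Longrightarrow> (\<lambda>n. q n i y) \<longlonglongrightarrow> y"
    and \<phi>: "\<And>i. i \<in> {1..N} \<Longrightarrow> \<phi> i \<in> borel \<rightarrow>\<^sub>M count_space (UNIV :: nat set)"
    and D: "\<And>i. i \<in> {1..N} \<Longrightarrow> range (D i) \<subseteq> U i"
    and less: "team_cost N X P Y W c (\<lambda>i y. D i (\<phi> i y)) < a"
  shows "\<forall>\<^sub>F n in sequentially. (INF \<gamma>\<in>quantized_policies N Y U (q n). team_cost N X P Y W c \<gamma>) < a"
proof -
  let ?L = "joint_law N X P Y W"
  interpret L: prob_space ?L by (rule prob_space_joint_law)
  let ?s = "\<lambda>i y. D i (\<phi> i y)"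
  have s: "?s i \<in> agent_policies (Y i) (U i)" if "i \<in> {1..N}" for i
    by (rule agent_policies_comp_index[OF \<phi>[OF that] D[OF that]])
  \<comment> \<open>A level \<open>b\<close> strictly between the cost and \<open>a\<close> absorbs
    the exceptional set and still leaves a strict inequality. Being below \<open>a\<close> it is
    finite, so the gap is a difference of reals.\<close>
  obtain b where b: "team_cost N X P Y W c ?s < b" "b < a" using dense[OF less] by blast
  obtain j b' where jb: "0 \<le> j" "j < b'" "team_cost N X P Y W c ?s = ennreal j" "b = ennreal b'"
    using b by (cases "team_cost N X P Y W c ?s" rule: ennreal_cases; cases b rule: ennreal_cases)
      (auto simp: ennreal_less_iff)
  \<comment> \<open>The probability allowed to the exceptional set: at cost at most \<open>C\<close>
    it uses no more than the gap \<open>b' - j\<close>. The \<open>+ 1\<close> avoids dividing by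
    zero when \<open>C = 0\<close>.\<close>
  define \<eta> where "\<eta> = (b' - j) / (C + 1)"
  have \<eta>: "0 < \<eta>" "j + C * \<eta> \<le> b'"
    using jb C by (auto simp: \<eta>_def field_simps)
  \<comment> \<open>The approximation is made under the law of the \<open>i\<close>-th observation,
    viewed on the whole type. Each agent gets an equal share of \<open>\<eta>\<close>, with
    \<open>+ 1\<close> for \<open>N = 0\<close>.\<close>
  have "\<exists>K \<psi>. compact K \<and> measure (distr ?L borel (\<lambda>p. snd p i)) (- K) < \<eta> / (real N + 1) \<and>
      \<psi> \<in> borel \<rightarrow>\<^sub>M count_space UNIV \<and> (\<forall>x\<in>K. \<forall>\<^sub>F z in nhds x. \<psi> z = \<phi> i x)"
    if i: "i \<in> {1..N}" for i
  proof -
    have "(\<lambda>p. snd p i) \<in> borel_measurable ?L"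
      using measurable_observation[OF i] by (simp add: measurable_restrict_space2_iff)
    then have "finite_measure (distr ?L borel (\<lambda>p. snd p i))"
      by (rule L.finite_measure_distr)
    from locally_constant_approximation[OF _ this \<phi>[OF i], of "\<eta> / (real N + 1)"] \<eta>
    show ?thesis by simp metis
  qed
  then obtain K \<psi> where K: "\<And>i. i \<in> {1..N} \<Longrightarrow> compact (K i)"
    and K_small: "\<And>i. i \<in> {1..N} \<Longrightarrow>
          measure (distr ?L borel (\<lambda>p. snd p i)) (- K i) < \<eta> / (real N + 1)"
    and \<psi>: "\<And>i. i \<in> {1..N} \<Longrightarrow> \<psi> i \<in> borel \<rightarrow>\<^sub>M count_space UNIV"
    and \<psi>_eq: "\<And>i x. i \<in> {1..N} \<Longrightarrow> x \<in> K i \<Longrightarrow> \<forall>\<^sub>F z in nhds x. \<psi> i z = \<phi> i x"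
    by metis
  define B where "B i = (\<lambda>p. snd p i) -` (- K i) \<inter> space ?L" for i
  have B: "B i \<in> sets ?L" "measure ?L (B i) < \<eta> / (real N + 1)" if i: "i \<in> {1..N}" for i
  proof -
    have m: "(\<lambda>p. snd p i) \<in> borel_measurable ?L"
      using measurable_observation[OF i] by (simp add: measurable_restrict_space2_iff)
    have Ki: "- K i \<in> sets borel" using borel_compact[OF K[OF i]] by auto
    show "B i \<in> sets ?L" unfolding B_def using m Ki by (rule measurable_sets)
    show "measure ?L (B i) < \<eta> / (real N + 1)"
      using K_small[OF i] unfolding B_def measure_distr[OF m Ki] .
  qed
  define G where "G = space ?L - (\<Union>i\<in>{1..N}. B i)"
  have G: "G \<in> sets ?L" unfolding G_def using B(1) by (intro sets.Diff sets.finite_UN) auto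
  have "measure ?L (space ?L - G) = measure ?L (\<Union>i\<in>{1..N}. B i)"
    unfolding G_def by (rule arg_cong[where f="measure ?L"]) (auto simp: B_def)
  also have "\<dots> \<le> (\<Sum>i\<in>{1..N}. measure ?L (B i))"
    using B(1) by (intro measure_UNION_le) auto
  also have "\<dots> \<le> (\<Sum>i\<in>{1..N}. \<eta> / (real N + 1))"
    using B(2) by (intro sum_mono less_imp_le)
  also have "\<dots> \<le> \<eta>" using \<eta> by (simp add: field_simps)
  finally have small: "measure ?L (space ?L - G) \<le> \<eta>" .
  \<comment> \<open>The locally constant \<open>\<psi> i\<close> is quantized, not
    \<open>\<phi> i\<close>, whose values at the net points may be unrelated to those
    nearby.\<close>
  define h where "h n = (\<lambda>i\<in>{1..N}. (\<lambda>y. D i (\<psi> i y)) \<circ> q n i)" for n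
  have base: "(\<lambda>y. D i (\<psi> i y)) \<in> agent_policies (Y i) (U i)" if "i \<in> {1..N}" for i
    by (rule agent_policies_comp_index[OF \<psi>[OF that] D[OF that]])
  have h_quantized: "h n \<in> quantized_policies N Y U (q n)" for n
    unfolding h_def quantized_policies_def using base by (intro restrict_PiE_iff[THEN iffD2]) blast
  have h: "h n i \<in> agent_policies (Y i) (U i)" if "i \<in> {1..N}" for n i
    using measurable_comp[OF q[OF that] base[OF that, unfolded agent_policies_def]] that
    by (simp add: h_def agent_policies_def)
  let ?I = "\<lambda>\<gamma>. \<integral>\<^sup>+ p. ennreal (c (fst p) (snd p) (\<lambda>i\<in>{1..N}. \<gamma> i (snd p i))) * indicator G p \<partial>?L"
  have "(\<lambda>n. ?I (h n)) \<longlonglongrightarrow> ?I ?s"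
  \<comment> \<open>On \<open>G\<close> every \<open>y i\<close> lies in \<open>K i\<close>, so the
    quantized point eventually enters the neighbourhood where \<open>\<psi> i\<close> has the value
    \<open>\<phi> i (y i)\<close>, and the actions then coincide exactly. The threshold depends on
    the point, hence the passage through pointwise convergence.\<close>
  proof (rule cost_tendsto_on[OF bound cont h s G])
    fix x y i assume xy: "(x, y) \<in> G" and i: "i \<in> {1..N}"
    then have y: "y i \<in> Y i" "y i \<in> K i"
      unfolding G_def B_def by (auto simp: space_joint_law)
    have "\<forall>\<^sub>F n in sequentially. \<psi> i (q n i (y i)) = \<phi> i (y i)"
      using \<psi>_eq[OF i y(2)] q_lim[OF i y(1)] by (rule eventually_compose_filterlim)
    then have "\<forall>\<^sub>F n in sequentially. h n i (y i) = ?s i (y i)"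
      by eventually_elim (use i in \<open>simp add: h_def\<close>)
    then show "(\<lambda>n. h n i (y i)) \<longlonglongrightarrow> ?s i (y i)"
      by (rule tendsto_eventually)
  qed
  then have "(\<lambda>n. ?I (h n) + ennreal C * emeasure ?L (space ?L - G))
      \<longlonglongrightarrow> ?I ?s + ennreal C * emeasure ?L (space ?L - G)"
    by (intro tendsto_add tendsto_const)
  moreover have "?I ?s + ennreal C * emeasure ?L (space ?L - G) < a"
  proof -
    have "?I ?s \<le> ennreal j"
      unfolding jb(3)[symmetric] team_cost_eq
      by (intro nn_integral_mono) (auto simp: indicator_def)
    moreover have "ennreal C * emeasure ?L (space ?L - G) \<le> ennreal (C * \<eta>)"
      using small C by (simp add: L.emeasure_eq_measure ennreal_mult[symmetric] mult_left_mono ennreal_leI)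
    ultimately have "?I ?s + ennreal C * emeasure ?L (space ?L - G) \<le> ennreal j + ennreal (C * \<eta>)"
      by (rule add_mono)
    also have "\<dots> = ennreal (j + C * \<eta>)" using jb C \<eta> by simp
    also have "\<dots> \<le> b" unfolding jb(4) using \<eta>(2) by (rule ennreal_leI)
    finally show ?thesis using b(2) by simp
  qed
  ultimately have "\<forall>\<^sub>F n in sequentially. ?I (h n) + ennreal C * emeasure ?L (space ?L - G) < a"
    by (rule order_tendstoD)
  then show ?thesis
  proof eventually_elim
    case (elim n)
    have "(INF \<gamma>\<in>quantized_policies N Y U (q n). team_cost N X P Y W c \<gamma>) \<le> team_cost N X P Y W c (h n)"
      by (rule INF_lower[OF h_quantized])
    also have "\<dots> \<le> ?I (h n) + ennreal C * emeasure ?L (space ?L - G)"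
      by (rule team_cost_le_on[OF bound h G])
    finally show ?case using elim by simp
  qed
qed

text \<open>Approximants within \<open>1 / (k + 1)\<close> of \<open>\<gamma>\<close> have costs
  tending to that of \<open>\<gamma>\<close>, so a single \<open>k\<close> suffices for a strict
  bound. It is fixed before any quantization, which avoids a double limit.\<close>

lemma countable_range_cost_less:
  assumes bound: "\<And>x y u. x \<in> X \<Longrightarrow> y \<in> (\<Pi>\<^sub>E i\<in>{1..N}. Y i) \<Longrightarrow> u \<in> (\<Pi>\<^sub>E i\<in>{1..N}. U i) \<Longrightarrow> c x y u \<le> C"
    and cont: "\<And>x. x \<in> X \<Longrightarrow>
         continuous_map
           (prod_topology (product_topology (\<lambda>i. top_of_set (Y i)) {1..N})
                          (product_topology (\<lambda>i. top_of_set (U i)) {1..N}))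
           euclideanreal (\<lambda>(y, u). c x y u)"
    and \<gamma>: "\<gamma> \<in> team_policies N Y U"
    and less: "team_cost N X P Y W c \<gamma> < a"
  obtains \<phi> D where "\<forall>i\<in>{1..N}. \<phi> i \<in> borel \<rightarrow>\<^sub>M count_space (UNIV :: nat set)"
    "\<forall>i\<in>{1..N}. range (D i) \<subseteq> U i"
    "team_cost N X P Y W c (\<lambda>i y. D i (\<phi> i y)) < a"
proof -
  let ?L = "joint_law N X P Y W"
  have \<gamma>i: "\<gamma> i \<in> agent_policies (Y i) (U i)" if "i \<in> {1..N}" for i
    using \<gamma> that by (auto simp: team_policies_def)
  have "\<exists>D \<phi>. \<phi> \<in> borel \<rightarrow>\<^sub>M count_space (UNIV :: nat set) \<and> range D \<subseteq> U i \<and>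
      (\<forall>y\<in>Y i. dist (D (\<phi> y)) (\<gamma> i y) < 1 / real (Suc k))" if i: "i \<in> {1..N}" for i k
  proof -
    obtain f where f: "f \<in> borel_measurable borel" "\<And>y. f y \<in> U i" "\<And>y. y \<in> Y i \<Longrightarrow> f y = \<gamma> i y"
      using agent_policies_imp_measurable_extension[OF i \<gamma>i[OF i]] by blast
    obtain D :: "nat \<Rightarrow> 'u" and \<phi> where "range D \<subseteq> U i" "\<phi> \<in> borel \<rightarrow>\<^sub>M count_space UNIV"
        "\<And>x. dist (D (\<phi> x)) (f x) < 1 / real (Suc k)"
      using countable_range_approximation[OF f(1,2), of "1 / real (Suc k)"] by auto
    then show ?thesis using f(3) by metis
  qed
  then obtain D \<phi> where \<phi>: "\<And>i k. i \<in> {1..N} \<Longrightarrow> \<phi> i k \<in> borel \<rightarrow>\<^sub>M count_space (UNIV :: nat set)"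
    and D: "\<And>i k. i \<in> {1..N} \<Longrightarrow> range (D i k) \<subseteq> U i"
    and close: "\<And>i k y. i \<in> {1..N} \<Longrightarrow> y \<in> Y i \<Longrightarrow>
        dist (D i k (\<phi> i k y)) (\<gamma> i y) < 1 / real (Suc k)"
    by metis
  have s: "(\<lambda>y. D i k (\<phi> i k y)) \<in> agent_policies (Y i) (U i)" if "i \<in> {1..N}" for k i
    by (rule agent_policies_comp_index[OF \<phi>[OF that] D[OF that]])
  have "(\<lambda>k. \<integral>\<^sup>+ p. ennreal (c (fst p) (snd p) (\<lambda>i\<in>{1..N}. D i k (\<phi> i k (snd p i))))
        * indicator (space ?L) p \<partial>?L)
      \<longlonglongrightarrow> (\<integral>\<^sup>+ p. ennreal (c (fst p) (snd p) (\<lambda>i\<in>{1..N}. \<gamma> i (snd p i))) * indicator (space ?L) p \<partial>?L)"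
  \<comment> \<open>The approximation holds at every observation, so the good set is the whole space
    here.\<close>
  proof (rule cost_tendsto_on[OF bound cont s \<gamma>i sets.top])
    fix x y i assume xy: "(x, y) \<in> space ?L" and i: "i \<in> {1..N}"
    then have y: "y i \<in> Y i" by (auto simp: space_joint_law)
    have "(\<lambda>k. dist (D i k (\<phi> i k (y i))) (\<gamma> i (y i))) \<longlonglongrightarrow> 0"
    proof (rule Lim_null_comparison[OF _ LIMSEQ_inverse_real_of_nat])
      show "\<forall>\<^sub>F k in sequentially. norm (dist (D i k (\<phi> i k (y i))) (\<gamma> i (y i))) \<le> inverse (real (Suc k))"
        using close[OF i y] by (auto intro!: always_eventually less_imp_le simp: inverse_eq_divide)
    qed
    then show "(\<lambda>k. D i k (\<phi> i k (y i))) \<longlonglongrightarrow> \<gamma> i (y i)"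
      by (simp add: tendsto_dist_iff[symmetric])
  qed
  then have "(\<lambda>k. team_cost N X P Y W c (\<lambda>i y. D i k (\<phi> i k y))) \<longlonglongrightarrow> team_cost N X P Y W c \<gamma>"
    unfolding team_cost_eq by (simp cong: nn_integral_cong)
  then have "\<forall>\<^sub>F k in sequentially. team_cost N X P Y W c (\<lambda>i y. D i k (\<phi> i k y)) < a"
    using less by (rule order_tendstoD)
  then obtain k where "team_cost N X P Y W c (\<lambda>i y. D i k (\<phi> i k y)) < a"
    by (auto simp: eventually_sequentially)
  with \<phi> D show thesis by (intro that[of "\<lambda>i. \<phi> i k" "\<lambda>i. D i k"]) auto
qed

section \<open>The limit of the infima\<close>

lemma quantized_policies_subset:
  assumes "\<And>i. i \<in> {1..N} \<Longrightarrow> q i \<in> restrict_space borel (Y i) \<rightarrow>\<^sub>M restrict_space borel (Y i)"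
  shows "quantized_policies N Y U q \<subseteq> team_policies N Y U"
  unfolding quantized_policies_def team_policies_def
proof (rule PiE_mono)
  show "(\<lambda>\<gamma>. \<gamma> \<circ> q i) ` agent_policies (Y i) (U i) \<subseteq> agent_policies (Y i) (U i)"
    if "i \<in> {1..N}" for i
    using measurable_comp[OF assms[OF that]] by (auto simp: agent_policies_def)
qed

text \<open>Quantizers for different \<open>n\<close> are unrelated, so the infima need not be
  monotone in \<open>n\<close>. The lower bound holds for each \<open>n\<close> by inclusion of the
  policy sets; the upper bound holds eventually, below any level above the optimal cost.\<close>

lemma quantized_cost_tendsto:
  assumes bound: "\<And>x y u. x \<in> X \<Longrightarrow> y \<in> (\<Pi>\<^sub>E i\<in>{1..N}. Y i) \<Longrightarrow> u \<in> (\<Pi>\<^sub>E i\<in>{1..N}. U i) \<Longrightarrow> c x y u \<le> C"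
    and cont: "\<And>x. x \<in> X \<Longrightarrow>
         continuous_map
           (prod_topology (product_topology (\<lambda>i. top_of_set (Y i)) {1..N})
                          (product_topology (\<lambda>i. top_of_set (U i)) {1..N}))
           euclideanreal (\<lambda>(y, u). c x y u)"
    and q: "\<And>n i. i \<in> {1..N} \<Longrightarrow> q n i \<in> restrict_space borel (Y i) \<rightarrow>\<^sub>M restrict_space borel (Y i)"
    and q_lim: "\<And>i y. i \<in> {1..N} \<Longrightarrow> y \<in> Y i \<Longrightarrow> (\<lambda>n. q n i y) \<longlonglongrightarrow> y"
  shows "(\<lambda>n. INF \<gamma>\<in>quantized_policies N Y U (q n). team_cost N X P Y W c \<gamma>)
           \<longlonglongrightarrow> (INF \<gamma>\<in>team_policies N Y U. team_cost N X P Y W c \<gamma>)"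
proof (rule order_tendstoI)
  fix a assume a: "a < (INF \<gamma>\<in>team_policies N Y U. team_cost N X P Y W c \<gamma>)"
  have "(INF \<gamma>\<in>team_policies N Y U. team_cost N X P Y W c \<gamma>)
      \<le> (INF \<gamma>\<in>quantized_policies N Y U (q n). team_cost N X P Y W c \<gamma>)" for n
    using quantized_policies_subset[OF q] by (intro INF_superset_mono) auto
  with a show "\<forall>\<^sub>F n in sequentially. a < (INF \<gamma>\<in>quantized_policies N Y U (q n). team_cost N X P Y W c \<gamma>)"
    by (intro always_eventually allI) (rule less_le_trans)
next
  fix a assume "(INF \<gamma>\<in>team_policies N Y U. team_cost N X P Y W c \<gamma>) < a"
  then obtain \<gamma> where \<gamma>: "\<gamma> \<in> team_policies N Y U" "team_cost N X P Y W c \<gamma> < a"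
    by (auto simp: INF_less_iff)
  obtain D \<phi> where s: "\<forall>i\<in>{1..N}. \<phi> i \<in> borel \<rightarrow>\<^sub>M count_space (UNIV :: nat set)"
    "\<forall>i\<in>{1..N}. range (D i) \<subseteq> U i"
    "team_cost N X P Y W c (\<lambda>i y. D i (\<phi> i y)) < a"
    by (rule countable_range_cost_less[OF bound cont \<gamma>])
  show "\<forall>\<^sub>F n in sequentially. (INF \<gamma>\<in>quantized_policies N Y U (q n). team_cost N X P Y W c \<gamma>) < a"
  \<comment> \<open>\<open>C\<close> is given only as an upper bound; the maximum supplies its sign
    without exhibiting a point at which to evaluate \<open>c\<close>.\<close>
  proof (rule eventually_quantized_cost_less[where C="max C 0" and q=q and \<phi>=\<phi> and D=D])
    show "c x y u \<le> max C 0"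
      if "x \<in> X" "y \<in> (\<Pi>\<^sub>E i\<in>{1..N}. Y i)" "u \<in> (\<Pi>\<^sub>E i\<in>{1..N}. U i)" for x y u
      using bound[OF that] by simp
    show "\<phi> i \<in> borel \<rightarrow>\<^sub>M count_space UNIV" if "i \<in> {1..N}" for i
      using s(1) that by (rule bspec)
    show "range (D i) \<subseteq> U i" if "i \<in> {1..N}" for i
      using s(2) that by (rule bspec)
  qed (fact cont q q_lim s(3) | simp)+
qed

end

theorem theorem4:
  fixes N :: nat
    and X :: "'x::polish_space set" and P :: "'x measure"
    and Y :: "nat \<Rightarrow> 'y::polish_space set" and d :: "nat \<Rightarrow> 'y \<Rightarrow> 'y \<Rightarrow> real"
    and W :: "nat \<Rightarrow> 'x \<Rightarrow> 'y measure"
    and U :: "nat \<Rightarrow> 'u::polish_space set"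
    and c :: "'x \<Rightarrow> (nat \<Rightarrow> 'y) \<Rightarrow> (nat \<Rightarrow> 'u) \<Rightarrow> real"
    and V :: "nat \<Rightarrow> 'v::real_vector topology" and e :: "nat \<Rightarrow> 'u \<Rightarrow> 'v"
    and Yn :: "nat \<Rightarrow> nat \<Rightarrow> 'y set" and q :: "nat \<Rightarrow> nat \<Rightarrow> 'y \<Rightarrow> 'y"
  assumes team: "static_team N X P Y d W U c"
    and c_bounded:
      "\<exists>K. \<forall>x\<in>X. \<forall>y\<in>(\<Pi>\<^sub>E i\<in>{1..N}. Y i). \<forall>u\<in>(\<Pi>\<^sub>E i\<in>{1..N}. U i). c x y u \<le> K"
    and c_continuous:
      "\<And>x. x \<in> X \<Longrightarrow>
         continuous_map
           (prod_topology (product_topology (\<lambda>i. top_of_set (Y i)) {1..N})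
                          (product_topology (\<lambda>i. top_of_set (U i)) {1..N}))
           euclideanreal (\<lambda>(y, u). c x y u)"
    and V_locally_convex: "\<And>i. i \<in> {1..N} \<Longrightarrow> locally_convex_space (V i)"
    and U_embedded: "\<And>i. i \<in> {1..N} \<Longrightarrow> embedding_map (top_of_set (U i)) (V i) (e i)"
    and U_convex: "\<And>i. i \<in> {1..N} \<Longrightarrow> convex (e i ` U i)"
    and Y_compact: "\<And>i. i \<in> {1..N} \<Longrightarrow> compact (Y i)"
    and net: "\<And>n i. n \<ge> 1 \<Longrightarrow> i \<in> {1..N} \<Longrightarrow> finite_net (Y i) (d i) (1 / real n) (Yn n i)"
    and quantizer: "\<And>n i. n \<ge> 1 \<Longrightarrow> i \<in> {1..N} \<Longrightarrow>
         nearest_neighbor_quantizer (Y i) (d i) (Yn n i) (q n i)"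
  shows "(\<lambda>n. INF \<gamma>\<in>quantized_policies N Y U (q n). team_cost N X P Y W c \<gamma>)
           \<longlonglongrightarrow> (INF \<gamma>\<in>team_policies N Y U. team_cost N X P Y W c \<gamma>)"
proof -
  interpret static_team N X P Y d W U c by (rule team)
  obtain C where bound: "\<And>x y u. x \<in> X \<Longrightarrow> y \<in> (\<Pi>\<^sub>E i\<in>{1..N}. Y i) \<Longrightarrow>
      u \<in> (\<Pi>\<^sub>E i\<in>{1..N}. U i) \<Longrightarrow> c x y u \<le> C"
    using c_bounded by blast
  \<comment> \<open>The nets and quantizers are constrained from index \<open>1\<close> on, and
    \<open>q 0\<close> is arbitrary; the shift by one leaves the limit unchanged.\<close>
  have "(\<lambda>n. INF \<gamma>\<in>quantized_policies N Y U (q (Suc n)). team_cost N X P Y W c \<gamma>)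
      \<longlonglongrightarrow> (INF \<gamma>\<in>team_policies N Y U. team_cost N X P Y W c \<gamma>)"
  proof (rule quantized_cost_tendsto[OF bound c_continuous])
    show "q (Suc n) i \<in> restrict_space borel (Y i) \<rightarrow>\<^sub>M restrict_space borel (Y i)"
      if "i \<in> {1..N}" for n i
      using quantizer[OF _ that, of "Suc n"] by (simp add: nearest_neighbor_quantizer_def)
    show "(\<lambda>n. q (Suc n) i y) \<longlonglongrightarrow> y" if "i \<in> {1..N}" "y \<in> Y i" for i y
    proof (rule quantizer_tendsto[OF that])
      show "finite_net (Y i) (d i) (1 / real (Suc n)) (Yn (Suc n) i)" for n
        using net[OF _ that(1), of "Suc n"] by simp
      show "nearest_neighbor_quantizer (Y i) (d i) (Yn (Suc n) i) (q (Suc n) i)" for n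
        using quantizer[OF _ that(1), of "Suc n"] by simp
    qed
  qed
  then show ?thesis by (rule LIMSEQ_imp_Suc)
qed

end
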